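(* There exists $M\in\mathcal{LC}$ satisfying $(\beta_1)$ and $(\mathrm{dc})$ such that there does not exist a sequence of Lusky numbers for $M$.
   Context: $\mathbb{N}=\{0,1,2,\dots\}$. For a sequence $M=(M_p)_{p\in\mathbb{N}}$ of positive reals put $\mu_p:=M_p/M_{p-1}$ for $p\ge1$ and $\mu_0:=1$. $\mathcal{LC}$ is the set of all such $M$ with $M_0=1\le M_1$, $M_p^2\le M_{p-1}M_{p+1}$ for all $p\ge1$, and $\lim_{p\to\infty}(M_p)^{1/p}=+\infty$. $M$ has $(\beta_1)$ if there is an integer $Q\ge2$ with $\liminf_{p\to\infty}\mu_{Qp}/\mu_p>Q$. $M$ has $(\mathrm{dc})$ (derivation closedness) if there is $D\ge1$ with $M_{p+1}\le D^{p+1}M_p$ for all $p\in\mathbb{N}$. For integers $0\le k<l$, $$A_M(k,l):=\frac{(\mu_{l+1})^{l-k}}{\mu_{k+1}\cdots\mu_l},\qquad B_M(k,l):=\frac{\mu_{k+1}\cdots\mu_l}{(\mu_{k+1})^{l-k}}.$$ A strictly increasing sequence of nonnegative integers $(a_j)_{j\ge1}$ is called a sequence of Lusky numbers for $M$ if there exist constants $K\ge b>2$ such that for all $j\ge1$: $b\le\min\{A_M(a_j,a_{j+1}),B_M(a_j,a_{j+1})\}\le\max\{A_M(a_j,a_{j+1}),B_M(a_j,a_{j+1})\}\le K$. *)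

theory Defs
  imports "HOL-Analysis.Analysis"
begin

definition mu :: "(nat \<Rightarrow> real) \<Rightarrow> nat \<Rightarrow> real" where
  "mu M p = (if p = 0 then 1 else M p / M (p - 1))"

(* The value root 0 (M 0) = 0 plays no role in the limit. *)
definition LC :: "(nat \<Rightarrow> real) set" where
  "LC = {M. (\<forall>p. M p > 0) \<and> M 0 = 1 \<and> 1 \<le> M 1 \<and>
            (\<forall>p\<ge>1. (M p)\<^sup>2 \<le> M (p - 1) * M (p + 1)) \<and>
            filterlim (\<lambda>p. root p (M p)) at_top sequentially}"

(* The lower limit is taken in the extended reals, so that the value infinity is admitted. *)
definition beta1 :: "(nat \<Rightarrow> real) \<Rightarrow> bool" where
  "beta1 M \<longleftrightarrow>
     (\<exists>Q::nat. Q \<ge> 2 \<and> liminf (\<lambda>p. ereal (mu M (Q * p) / mu M p)) > ereal (real Q))"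

definition derivation_closed :: "(nat \<Rightarrow> real) \<Rightarrow> bool" where
  "derivation_closed M \<longleftrightarrow> (\<exists>D::real. D \<ge> 1 \<and> (\<forall>p. M (p + 1) \<le> D ^ (p + 1) * M p))"

(* The next two are only meant for k < l, so the subtraction l - k does not truncate. *)
definition A_seq :: "(nat \<Rightarrow> real) \<Rightarrow> nat \<Rightarrow> nat \<Rightarrow> real" where
  "A_seq M k l = mu M (l + 1) ^ (l - k) / (\<Prod>i=k+1..l. mu M i)"

definition B_seq :: "(nat \<Rightarrow> real) \<Rightarrow> nat \<Rightarrow> nat \<Rightarrow> real" where
  "B_seq M k l = (\<Prod>i=k+1..l. mu M i) / mu M (k + 1) ^ (l - k)"

(* The sequence is indexed from 1; the value a 0 is irrelevant. *)
definition lusky_numbers :: "(nat \<Rightarrow> real) \<Rightarrow> (nat \<Rightarrow> nat) \<Rightarrow> bool" where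
  "lusky_numbers M a \<longleftrightarrow> strict_mono_on {1..} a \<and>
     (\<exists>K b::real. K \<ge> b \<and> b > 2 \<and>
        (\<forall>j\<ge>1. b \<le> min (A_seq M (a j) (a (j + 1))) (B_seq M (a j) (a (j + 1))) \<and>
               max (A_seq M (a j) (a (j + 1))) (B_seq M (a j) (a (j + 1))) \<le> K))"

end

theory Submission
  imports Defs "HOL-Library.Discrete_Functions"
begin

text \<open>
  If the quotients \<open>mu M\<close> increase, then \<open>A_seq M k l\<close> and \<open>B_seq M k l\<close> are products of factors
  that are at least \<open>1\<close>, namely of \<open>mu M (l + 1) / mu M i\<close> and of \<open>mu M i / mu M (k + 1)\<close>
  with \<open>k < i \<le> l\<close>. Any consecutive pair \<open>n, n + 1\<close> with \<open>k < n \<le> l\<close> is seen by one of these factors: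
  if \<open>n = l\<close>, the factor of \<open>A_seq\<close> at \<open>i = l\<close> is \<open>mu M (n + 1) / mu M n\<close>; if \<open>n < l\<close>, the factor of
  \<open>B_seq\<close> at \<open>i = n + 1\<close> is at least this quotient. The intervals between consecutive Lusky numbers
  cover all large \<open>n\<close>, so the upper bound \<open>K\<close> of a Lusky sequence bounds
  \<open>mu M (n + 1) / mu M n\<close> for all large \<open>n\<close> (lemma \<open>no_lusky_numbers_if_unbounded_jumps\<close>).

  It thus suffices to find an increasing sequence of quotients with unbounded jumps that grows fast
  enough for \<open>beta1\<close> and slowly enough for \<open>derivation_closed\<close>. The step function
  \<open>2 ^ 2 ^ floor_log p\<close> is of this kind: for \<open>p \<ge> 1\<close> it is at most \<open>2 ^ p\<close>, it gets squared
  when \<open>p\<close> is doubled, and it makes this squaring in one single jump, on reaching each power of two.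
\<close>

section \<open>Large jumps of the quotients exclude Lusky numbers\<close>

lemma member_le_prod_ge_1:
  fixes f :: "'a \<Rightarrow> real"
  assumes "finite I" "j \<in> I" "\<And>i. i \<in> I \<Longrightarrow> 1 \<le> f i"
  shows "f j \<le> prod f I"
proof -
  have "1 \<le> prod f (I - {j})"
    using assms by (intro prod_ge_1) auto
  moreover have "0 \<le> f j"
    using assms(2,3) by (meson order_trans zero_le_one)
  ultimately have "f j * 1 \<le> f j * prod f (I - {j})"
    by (intro mult_left_mono) auto
  then show ?thesis
    using assms by (simp add: prod.remove)
qed

lemma A_seq_eq_prod: "A_seq M k l = (\<Prod>i=k+1..l. mu M (l + 1) / mu M i)"
  by (simp add: A_seq_def prod_dividef)

lemma B_seq_eq_prod: "B_seq M k l = (\<Prod>i=k+1..l. mu M i / mu M (k + 1))"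
  by (simp add: B_seq_def prod_dividef)

text \<open>Since \<open>mu M (k + 1) \<le> mu M n\<close>, a jump strictly inside the interval is visible in
  \<open>B_seq\<close>, whose factors stop at \<open>l\<close>; the jump from \<open>l\<close> to \<open>l + 1\<close> is visible in \<open>A_seq\<close>.\<close>

lemma jump_le_max_A_B:
  assumes pos: "\<And>p. 0 < mu M p" and mono: "mono_on {1..} (mu M)"
    and "k < n" "n \<le> l"
  shows "mu M (n + 1) / mu M n \<le> max (A_seq M k l) (B_seq M k l)"
proof (cases "n = l")
  case True
  have "mu M (l + 1) / mu M l \<le> A_seq M k l"
    unfolding A_seq_eq_prod using assms pos
    by (intro member_le_prod_ge_1[where f = "\<lambda>i. mu M (l + 1) / mu M i"])
       (auto intro!: mono_onD[OF mono])
  then show ?thesis using True by simp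
next
  case False
  have "mu M (n + 1) / mu M n \<le> mu M (n + 1) / mu M (k + 1)"
    using assms(3,4) by (intro divide_left_mono mono_onD[OF mono] mult_pos_pos pos less_imp_le[OF pos]) auto
  also have "\<dots> \<le> B_seq M k l"
    unfolding B_seq_eq_prod using assms pos False
    by (intro member_le_prod_ge_1[where f = "\<lambda>i. mu M i / mu M (k + 1)"])
       (auto intro!: mono_onD[OF mono])
  finally show ?thesis by simp
qed

lemma consecutive_interval_exists:
  fixes a :: "nat \<Rightarrow> nat"
  assumes mono: "strict_mono_on {1..} a" and "a 1 < n"
  shows "\<exists>j\<ge>1. a j < n \<and> n \<le> a (j + 1)"
proof -
  have "i \<le> a (i + 1)" for i
  proof (induction i)
    case (Suc i)
    have "a (i + 1) < a (Suc i + 1)"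
      by (rule strict_mono_onD[OF mono]) auto
    with Suc show ?case by simp
  qed simp
  then have ex: "n \<le> a (n + 1)" .
  define j where "j = (LEAST i. n \<le> a (i + 1))"
  have j: "n \<le> a (j + 1)"
    unfolding j_def using ex by (rule LeastI)
  then have "j \<noteq> 0"
    using \<open>a 1 < n\<close> by (cases j) auto
  then have "\<not> n \<le> a (j - 1 + 1)"
    unfolding j_def by (intro not_less_Least) simp
  then show ?thesis
    using j \<open>j \<noteq> 0\<close> by (intro exI[of _ j]) auto
qed

lemma no_lusky_numbers_if_unbounded_jumps:
  assumes pos: "\<And>p. 0 < mu M p" and mono: "mono_on {1..} (mu M)"
    and jumps: "\<And>N K. \<exists>n>N. K < mu M (n + 1) / mu M n"
  shows "\<not> lusky_numbers M a"
proof
  assume "lusky_numbers M a"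
  then obtain K where a: "strict_mono_on {1..} a"
    and K: "\<And>j. 1 \<le> j \<Longrightarrow> max (A_seq M (a j) (a (j + 1))) (B_seq M (a j) (a (j + 1))) \<le> K"
    unfolding lusky_numbers_def by auto
  obtain n where n: "a 1 < n" "K < mu M (n + 1) / mu M n"
    using jumps by blast
  obtain j where "1 \<le> j" "a j < n" "n \<le> a (j + 1)"
    using consecutive_interval_exists[OF a n(1)] by blast
  then show False
    using jump_le_max_A_B[OF pos mono, of "a j" n "a (j + 1)"] K[of j] n(2) by linarith
qed

section \<open>Weight sequences with prescribed quotients\<close>

lemma mu_prod:
  fixes w :: "nat \<Rightarrow> real"
  assumes "\<And>i. 0 < w i" "1 \<le> p"
  shows "mu (\<lambda>p. \<Prod>i=1..p. w i) p = w p"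
proof -
  obtain q where q: "p = Suc q"
    using assms(2) by (cases p) auto
  have "0 < (\<Prod>i=1..q. w i)"
    using assms(1) by (intro prod_pos) auto
  then have "(\<Prod>i=1..q. w i) \<noteq> 0"
    by linarith
  moreover have "(\<Prod>i=1..Suc q. w i) = (\<Prod>i=1..q. w i) * w (Suc q)"
    by simp
  ultimately show ?thesis
    unfolding q mu_def by (simp del: prod_zero_iff prod.cl_ivl_Suc)
qed

text \<open>The upper half of the factors already suffices: there are at least \<open>p / 2\<close> of them, and
  each is at least \<open>w (p div 2)\<close>, so the geometric mean is at least the square root of this value.\<close>

lemma root_prod_at_top:
  fixes w :: "nat \<Rightarrow> real"
  assumes w: "\<And>i. 1 \<le> w i" "mono w" "filterlim w at_top sequentially"
  shows "filterlim (\<lambda>p. root p (\<Prod>i=1..p. w i)) at_top sequentially"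
proof (rule filterlim_at_top_mono)
  have "filterlim (\<lambda>p::nat. p div 2) at_top sequentially"
    unfolding filterlim_at_top eventually_sequentially
    by (metis div_le_mono nonzero_mult_div_cancel_left zero_neq_numeral)
  then show "filterlim (\<lambda>p. sqrt (w (p div 2))) at_top sequentially"
    by (intro filterlim_compose[OF sqrt_at_top] filterlim_compose[OF w(3)])
  have "sqrt (w (p div 2)) \<le> root p (\<Prod>i=1..p. w i)" if "0 < p" for p
  proof -
    define x where "x = w (p div 2)"
    have x: "1 \<le> x" using w(1) by (simp add: x_def)
    have "sqrt x ^ p \<le> sqrt x ^ (2 * (p - p div 2))"
      using x by (intro power_increasing) auto
    also have "\<dots> = x ^ (p - p div 2)"
      using x by (simp add: power_mult)
    also have "\<dots> = (\<Prod>i=p div 2 + 1..p. x)"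
      by simp
    also have "\<dots> \<le> (\<Prod>i=p div 2 + 1..p. w i)"
      using x by (intro prod_mono) (auto simp: x_def intro!: monoD[OF w(2)])
    also have "\<dots> \<le> (\<Prod>i=1..p. w i)"
      by (intro prod_mono2) (auto intro: order_trans[OF zero_le_one] w(1))
    finally have "root p (sqrt x ^ p) \<le> root p (\<Prod>i=1..p. w i)"
      using that by (intro real_root_le_mono)
    moreover have "root p (sqrt x ^ p) = sqrt x"
      using that x by (intro real_root_power_cancel) auto
    ultimately show ?thesis
      by (simp add: x_def)
  qed
  then show "eventually (\<lambda>p. sqrt (w (p div 2)) \<le> root p (\<Prod>i=1..p. w i)) sequentially"
    by (auto intro: eventually_mono[OF eventually_gt_at_top[of 0]])
qed

lemma prod_in_LC:
  fixes w :: "nat \<Rightarrow> real"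
  assumes w: "\<And>i. 1 \<le> w i" "mono w" "filterlim w at_top sequentially"
  shows "(\<lambda>p. \<Prod>i=1..p. w i) \<in> LC"
proof -
  let ?M = "\<lambda>p. \<Prod>i=1..p. w i"
  have wpos: "0 < w i" for i
    using w(1)[of i] by linarith
  have pos: "0 < ?M p" for p
    using wpos by (intro prod_pos) auto
  have "(?M p)\<^sup>2 \<le> ?M (p - 1) * ?M (p + 1)" if "1 \<le> p" for p
  proof -
    obtain q where q: "p = Suc q" using \<open>1 \<le> p\<close> by (cases p) auto
    have "?M q * ?M q * w (Suc q) * w (Suc q) \<le> ?M q * ?M q * w (Suc q) * w (Suc (Suc q))"
      using pos[of q] wpos[of "Suc q"] monoD[OF w(2), of "Suc q" "Suc (Suc q)"]
      by (intro mult_left_mono) auto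
    then show ?thesis
      by (simp add: q power2_eq_square mult_ac)
  qed
  then show ?thesis
    unfolding LC_def using pos w(1) root_prod_at_top[OF w] by simp
qed

section \<open>The doubly exponential step function\<close>

definition step_weight :: "nat \<Rightarrow> real" where
  "step_weight p = 2 ^ 2 ^ floor_log p"

lemma step_weight_ge_2: "2 \<le> step_weight p"
proof -
  have "(2::real) ^ 1 \<le> 2 ^ 2 ^ floor_log p"
    by (intro power_increasing) auto
  then show ?thesis by (simp add: step_weight_def)
qed

lemma mono_step_weight: "mono step_weight"
  by (auto simp: mono_def step_weight_def intro!: power_increasing floor_log_le_iff)

lemma step_weight_le: "1 \<le> p \<Longrightarrow> step_weight p \<le> 2 ^ p"
  unfolding step_weight_def by (intro power_increasing floor_log_exp2_le) auto

lemma step_weight_at_top: "filterlim step_weight at_top sequentially"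
proof (rule filterlim_at_top_mono)
  show "filterlim (\<lambda>p::nat. real p / 2) at_top sequentially"
    by real_asymp
  have "real p / 2 \<le> step_weight p" for p
  proof -
    have "real p \<le> real (2 * 2 ^ floor_log p)"
      using floor_log_exp2_ge[of p] by (simp only: of_nat_le_iff)
    also have "\<dots> = 2 * real (2 ^ floor_log p)"
      by simp
    also have "\<dots> \<le> 2 * step_weight p"
      unfolding step_weight_def by (intro mult_left_mono less_imp_le of_nat_less_two_power) simp
    finally show ?thesis by simp
  qed
  then show "eventually (\<lambda>p. real p / 2 \<le> step_weight p) sequentially"
    by simp
qed

lemma step_weight_double: "1 \<le> p \<Longrightarrow> step_weight (2 * p) = (step_weight p)\<^sup>2"
  unfolding step_weight_def by (simp add: power_even_eq)

lemma step_weight_jumps: "\<exists>n>N. K < step_weight (n + 1) / step_weight n"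
proof -
  obtain m0 where m0: "K < 2 ^ m0"
    using real_arch_pow[of 2 K] by auto
  \<comment> \<open>On reaching \<open>2 ^ Suc m\<close> the weight jumps by the factor \<open>2 ^ 2 ^ m\<close>.\<close>
  define m where "m = max m0 (N + 1)"
  define n :: nat where "n = 2 ^ Suc m - 1"
  have n1: "n + 1 = 2 ^ Suc m"
    by (simp add: n_def)
  have "m < 2 ^ m"
    by simp
  then have n: "m < n"
    using n1 unfolding power_Suc by linarith
  have "2 ^ floor_log n \<le> n"
    using n by (intro floor_log_exp2_le) simp
  also have "n < 2 ^ Suc m"
    using n1 by simp
  finally have "floor_log n \<le> m"
    using power_less_imp_less_exp[of "2::nat" "floor_log n" "Suc m"] by simp
  then have le: "step_weight n \<le> 2 ^ 2 ^ m"
    by (auto simp: step_weight_def intro!: power_increasing)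
  have "K < 2 ^ m0" by (rule m0)
  also have "(2::real) ^ m0 \<le> 2 ^ 2 ^ m"
    by (intro power_increasing order_trans[OF _ less_imp_le[OF \<open>m < 2 ^ m\<close>]])
       (auto simp: m_def)
  also have "\<dots> = (2 ^ 2 ^ m)\<^sup>2 / (2 ^ 2 ^ m :: real)"
    by (simp add: power2_eq_square)
  also have "\<dots> \<le> (2 ^ 2 ^ m)\<^sup>2 / step_weight n"
    using le step_weight_ge_2[of n] by (intro divide_left_mono) auto
  also have "(2 ^ 2 ^ m)\<^sup>2 = step_weight (n + 1)"
    unfolding n1 step_weight_def floor_log_power by (simp add: power_mult[symmetric] mult.commute)
  finally show ?thesis
    using n by (intro exI[of _ n]) (auto simp: m_def)
qed

theorem corollary4p13:
  shows "\<exists>M \<in> LC. beta1 M \<and> derivation_closed M \<and> \<not> (\<exists>a. lusky_numbers M a)"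
proof -
  define M where "M = (\<lambda>p. \<Prod>i=1..p. step_weight i)"
  have wpos: "0 < step_weight i" for i
    using step_weight_ge_2[of i] by linarith
  have mu: "mu M p = step_weight p" if "1 \<le> p" for p
    unfolding M_def using wpos that by (rule mu_prod)
  have "M \<in> LC"
    unfolding M_def
    using step_weight_ge_2 mono_step_weight step_weight_at_top
    by (intro prod_in_LC) (auto intro: order_trans[of 1 2])
  moreover have "beta1 M"
  proof -
    \<comment> \<open>The quotient below is \<open>step_weight p\<close>; at \<open>p = 1\<close> it is \<open>2\<close>, which does not exceed \<open>Q = 2\<close>.\<close>
    have "4 \<le> mu M (2 * p) / mu M p" if "2 \<le> p" for p
    proof -
      have "mu M (2 * p) / mu M p = step_weight p"
        using that wpos[of p] by (simp add: mu step_weight_double power2_eq_square)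
      moreover have "step_weight 2 \<le> step_weight p"
        using that by (rule monoD[OF mono_step_weight])
      moreover have "step_weight 2 = 4"
        using floor_log_power[of 1] by (simp add: step_weight_def)
      ultimately show ?thesis by simp
    qed
    then have "ereal 4 \<le> liminf (\<lambda>p. ereal (mu M (2 * p) / mu M p))"
      by (intro Liminf_bounded eventually_mono[OF eventually_ge_at_top[of 2]]) auto
    then have "ereal (real 2) < liminf (\<lambda>p. ereal (mu M (2 * p) / mu M p))"
      by (rule less_le_trans[rotated]) simp
    then show ?thesis
      unfolding beta1_def by blast
  qed
  moreover have "derivation_closed M"
  proof -
    have "M (p + 1) \<le> 2 ^ (p + 1) * M p" for p
    proof -
      have "M (p + 1) = step_weight (p + 1) * M p"
        by (simp add: M_def mult.commute)
      also have "\<dots> \<le> 2 ^ (p + 1) * M p"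
        unfolding M_def by (intro mult_right_mono step_weight_le prod_nonneg less_imp_le[OF wpos]) simp
      finally show ?thesis .
    qed
    then show ?thesis
      unfolding derivation_closed_def by (intro exI[of _ 2]) simp
  qed
  moreover have "\<not> lusky_numbers M a" for a
  proof (rule no_lusky_numbers_if_unbounded_jumps)
    show "0 < mu M p" for p
      using mu[of p] wpos[of p] by (cases "p = 0") (auto simp: mu_def)
    show "mono_on {1..} (mu M)"
      by (auto simp: mono_on_def mu intro: monoD[OF mono_step_weight])
    show "\<exists>n>N. K < mu M (n + 1) / mu M n" for N K
    proof -
      obtain n where "N < n" "K < step_weight (n + 1) / step_weight n"
        using step_weight_jumps by blast
      then show ?thesis
        by (intro exI[of _ n]) (auto simp: mu)
    qed
  qed
  ultimately show ?thesis by blast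
qed

end
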